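(* Let $X$ be a Banach space and let $\mu \in \mathcal{M}_+$. Then $(PAP(\mathbb{R}^+,X,\mu), \Vert \cdot \Vert_{\infty})$ is a Banach space.
   Context: $\mathbb{R}^+ = [0,+\infty)$. $\mathcal{B}_+$ denotes the Lebesgue $\sigma$-field of $\mathbb{R}^+$ and $\mathcal{M}_+$ the set of all positive measures $\mu$ on $\mathcal{B}_+$ satisfying $\mu(\mathbb{R}^+) = +\infty$ and $\mu([a,b]) < +\infty$ for all $0 \leq a \leq b$. $BC(\mathbb{R}^+,X)$ is the Banach space of all continuous bounded functions from $\mathbb{R}^+$ to $X$, with norm $\Vert f \Vert_{\infty} = \sup_{t \geq 0} \Vert f(t) \Vert$. A continuous function $f : \mathbb{R}^+ \to X$ is almost periodic (in the Bohr sense) if for all $\varepsilon > 0$ there exists $\ell > 0$ such that for all $\alpha \geq 0$ there exists $\tau \in [\alpha,\alpha+\ell]$ with $\sup_{t \geq 0} \Vert f(t+\tau)-f(t) \Vert < \varepsilon$. $AP(\mathbb{R}^+,X)$ denotes the space of all such functions. For $\mu \in \mathcal{M}_+$, a function $f \in BC(\mathbb{R}^+,X)$ is $\mu$-ergodic if $\lim_{r \to +\infty} \frac{1}{\mu([0,r])} \int_{[0,r]} \Vert f(t) \Vert \, d\mu(t) = 0$. $\mathcal{E}(\mathbb{R}^+,X,\mu)$ denotes the space of all such functions. A function $f \in BC(\mathbb{R}^+,X)$ is $\mu$-pseudo almost periodic if $f = g+\phi$ with $g \in AP(\mathbb{R}^+,X)$ and $\phi \in \mathcal{E}(\mathbb{R}^+,X,\mu)$.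 $PAP(\mathbb{R}^+,X,\mu)$ denotes the space of all such functions. *)

theory Defs
  imports "HOL-Analysis.Analysis"
begin

section \<open>The half-line $[0,+\infty)$\<close>

text \<open>
  The half-line is made a type, with the order, the addition and the metric of the reals, so that
  the library type of bounded continuous functions, with its supremum norm, can be used for
  functions defined on it.
\<close>

typedef nnreal = "{0::real..}"
  morphisms real_of_nnreal Abs_nnreal
  by auto

setup_lifting type_definition_nnreal

instantiation nnreal :: linorder
begin

lift_definition less_eq_nnreal :: "nnreal \<Rightarrow> nnreal \<Rightarrow> bool" is "(\<le>)" .

lift_definition less_nnreal :: "nnreal \<Rightarrow> nnreal \<Rightarrow> bool" is "(<)" .

instance
  by standard (transfer; auto)+

end

instantiation nnreal :: comm_monoid_add
begin

lift_definition zero_nnreal :: nnreal is 0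
  by simp

lift_definition plus_nnreal :: "nnreal \<Rightarrow> nnreal \<Rightarrow> nnreal" is "(+)"
  by simp

instance
  by standard (transfer; simp)+

end

instantiation nnreal :: metric_space
begin

lift_definition dist_nnreal :: "nnreal \<Rightarrow> nnreal \<Rightarrow> real" is dist .

definition uniformity_nnreal :: "(nnreal \<times> nnreal) filter" where
  "uniformity_nnreal = (INF e\<in>{0<..}. principal {(x, y). dist x y < e})"

definition open_nnreal :: "nnreal set \<Rightarrow> bool" where
  "open_nnreal U = (\<forall>x\<in>U. \<forall>\<^sub>F (x', y) in uniformity. x' = x \<longrightarrow> y \<in> U)"

instance
proof
  show "uniformity = (INF e\<in>{0<..}. principal {(x :: nnreal, y). dist x y < e})"
    by (rule uniformity_nnreal_def)
  show "open U \<longleftrightarrow> (\<forall>x\<in>U. \<forall>\<^sub>F (x', y) in uniformity. x' = x \<longrightarrow> y \<in> U)" for U :: "nnreal set"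
    by (rule open_nnreal_def)
  show "dist x y = 0 \<longleftrightarrow> x = y" for x y :: nnreal
    by transfer simp
  show "dist x y \<le> dist x z + dist y z" for x y z :: nnreal
    by transfer (rule dist_triangle2)
qed

end


section \<open>Measures on the half-line\<close>

definition lebesgue_sets_nnreal :: "nnreal set set" where
  "lebesgue_sets_nnreal = sets (vimage_algebra UNIV real_of_nnreal lebesgue)"

lemma lebesgue_sets_nnreal_eq:
  "lebesgue_sets_nnreal = {A. real_of_nnreal ` A \<in> sets lebesgue}"
proof -
  have range: "range real_of_nnreal = {0..}"
    using type_definition.Rep_range[OF type_definition_nnreal] .
  have img: "real_of_nnreal ` (real_of_nnreal -` B) \<in> sets lebesgue" if "B \<in> sets lebesgue" for B
  proof -
    have "{0::real..} \<in> sets lebesgue"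
      by (rule sets_completionI_sets) simp
    with that have "B \<inter> {0..} \<in> sets lebesgue"
      by (rule sets.Int)
    then show ?thesis
      by (simp add: image_vimage_eq range)
  qed
  have vimg: "A = real_of_nnreal -` (real_of_nnreal ` A)" for A
    by (simp add: inj_vimage_image_eq inj_def real_of_nnreal_inject)
  have "lebesgue_sets_nnreal = {real_of_nnreal -` B | B. B \<in> sets lebesgue}"
    unfolding lebesgue_sets_nnreal_def by (subst sets_vimage_algebra2) auto
  also have "\<dots> = {A. real_of_nnreal ` A \<in> sets lebesgue}"
  proof (intro equalityI subsetI)
    fix A assume "A \<in> {real_of_nnreal -` B | B. B \<in> sets lebesgue}"
    then show "A \<in> {A. real_of_nnreal ` A \<in> sets lebesgue}"
      using img by blast
  next
    fix A assume "A \<in> {A. real_of_nnreal ` A \<in> sets lebesgue}"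
    then show "A \<in> {real_of_nnreal -` B | B. B \<in> sets lebesgue}"
      using vimg[of A] by blast
  qed
  finally show ?thesis .
qed

definition measures_plus :: "nnreal measure set" where
  "measures_plus =
     {\<mu>. sets \<mu> = lebesgue_sets_nnreal \<and> emeasure \<mu> UNIV = \<infinity> \<and> (\<forall>a b. a \<le> b \<longrightarrow> emeasure \<mu> {a..b} < \<infinity>)}"


section \<open>Almost periodic, ergodic and pseudo almost periodic functions\<close>

text \<open>The supremum is taken in \<^typ>\<open>ereal\<close>, because the functions are not assumed to be bounded
  and the supremum of an unbounded set of reals is unspecified.\<close>

definition AP :: "(nnreal \<Rightarrow> 'a::real_normed_vector) set" where
  "AP = {f. continuous_on UNIV f \<and>
     (\<forall>\<epsilon>::real. \<epsilon> > 0 \<longrightarrow> (\<exists>l>0. \<forall>\<alpha>. \<exists>\<tau>\<in>{\<alpha>..\<alpha> + l}.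
        (SUP t. ereal (norm (f (t + \<tau>) - f t))) < ereal \<epsilon>))}"

definition ergodic :: "nnreal measure \<Rightarrow> (nnreal \<Rightarrow>\<^sub>C 'a::real_normed_vector) set" where
  "ergodic \<mu> = {f :: nnreal \<Rightarrow>\<^sub>C 'a. ((\<lambda>r. 1 / measure \<mu> {0..r} * (LINT t:{0..r}|\<mu>. norm (f t))) \<longlongrightarrow> 0) at_top}"

definition PAP :: "nnreal measure \<Rightarrow> (nnreal \<Rightarrow>\<^sub>C 'a::real_normed_vector) set" where
  "PAP \<mu> = {f :: nnreal \<Rightarrow>\<^sub>C 'a. \<exists>g\<in>AP. \<exists>\<phi>\<in>ergodic \<mu>. \<forall>t. f t = g t + \<phi> t}"

lemma norm_bcontfun_eq_SUP:
  fixes f :: "nnreal \<Rightarrow>\<^sub>C 'a::real_normed_vector"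
  shows "norm f = (SUP t. norm (f t))"
  by (simp add: norm_bcontfun_def dist_bcontfun_def)

end

theory Submission
  imports Defs
begin

text \<open>
  For a general \<open>\<mu>\<close> the decomposition \<open>f = g + \<phi>\<close> is not unique and \<open>g\<close> is not controlled by \<open>f\<close>.
  But \<open>g\<close> can be chosen with \<open>\<parallel>g\<parallel> \<le> \<parallel>f\<parallel>\<close>: compose it with the radial retraction \<open>T\<close> onto the ball of
  radius \<open>\<parallel>f\<parallel>\<close>. Since \<open>T\<close> is Lipschitz, \<open>T \<circ> g\<close> is almost periodic, and since
  \<open>\<parallel>g(t)\<parallel> \<le> \<parallel>f\<parallel> + \<parallel>\<phi>(t)\<parallel>\<close>, the error \<open>\<parallel>g(t) - T(g(t))\<parallel>\<close> is at most \<open>\<parallel>\<phi>(t)\<parallel>\<close>, hence ergodic.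
  With this norm bound the almost periodic and ergodic parts of an absolutely convergent series
  converge separately, so the sum of the two closed subspaces is closed.
\<close>

section \<open>The half-line\<close>

lemma real_of_nnreal_nonneg [simp]: "0 \<le> real_of_nnreal x"
  using real_of_nnreal[of x] by simp

lemmas nnreal_rep_eqs =
  less_eq_nnreal.rep_eq less_nnreal.rep_eq plus_nnreal.rep_eq zero_nnreal.rep_eq dist_nnreal.rep_eq

text \<open>The half-line has no subtraction; the witness \<open>z\<close> stands for
  \<open>y - x\<close>.\<close>

lemma nnreal_le_iff_add: "x \<le> y \<longleftrightarrow> (\<exists>z. y = z + x)" for x y :: nnreal
proof
  assume "x \<le> y"
  then have "y = Abs_nnreal (real_of_nnreal y - real_of_nnreal x) + x"
    by (simp add: nnreal_rep_eqs Abs_nnreal_inverse flip: real_of_nnreal_inject)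
  then show "\<exists>z. y = z + x" ..
qed (auto simp: nnreal_rep_eqs)

lemma continuous_on_Abs_nnreal:
  assumes "S \<subseteq> {0..}"
  shows "continuous_on S Abs_nnreal"
proof -
  have "dist (Abs_nnreal x) (Abs_nnreal y) = dist x y" if "x \<in> S" "y \<in> S" for x y
    using assms that by (auto simp: dist_nnreal.rep_eq Abs_nnreal_inverse subset_iff)
  then show ?thesis unfolding continuous_on_iff by auto
qed

text \<open>A compact real interval is carried over by \<open>Abs_nnreal\<close>, an isometry on the
  nonnegative reals.\<close>

lemma compact_atLeastAtMost_nnreal: "compact {0..b :: nnreal}"
proof -
  have "x \<in> Abs_nnreal ` {0..real_of_nnreal b}" if "x \<le> b" for x
    using that by (intro image_eqI[of _ _ "real_of_nnreal x"])
      (auto simp: real_of_nnreal_inverse nnreal_rep_eqs)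
  then have "{0..b} = Abs_nnreal ` {0..real_of_nnreal b}"
    by (auto simp: nnreal_rep_eqs Abs_nnreal_inverse)
  then show ?thesis
    by (simp add: compact_continuous_image continuous_on_Abs_nnreal)
qed


section \<open>Almost periodic functions\<close>

lemma SUP_ereal_less_imp: "(SUP t. ereal (F t)) < ereal e \<Longrightarrow> F t \<le> e"
  by (metis SUP_upper UNIV_I ereal_less_eq(3) less_imp_le order_trans)

text \<open>The strict bound on the supremum and the non-strict pointwise bound agree because
  \<epsilon> may be halved; adding 1 to \<open>l\<close> makes it positive.\<close>

lemma AP_iff:
  "f \<in> AP \<longleftrightarrow> continuous_on UNIV f \<and>
     (\<forall>e>0. \<exists>l. \<forall>\<alpha>. \<exists>\<tau>\<in>{\<alpha>..\<alpha> + l}. \<forall>t. dist (f (t + \<tau>)) (f t) \<le> e)"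
proof (intro iffI conjI allI impI)
  fix e :: real assume f: "f \<in> AP" and "e > 0"
  then obtain l where "\<And>\<alpha>. \<exists>\<tau>\<in>{\<alpha>..\<alpha> + l}. (SUP t. ereal (norm (f (t + \<tau>) - f t))) < ereal e"
    unfolding AP_def by blast
  then show "\<exists>l. \<forall>\<alpha>. \<exists>\<tau>\<in>{\<alpha>..\<alpha> + l}. \<forall>t. dist (f (t + \<tau>)) (f t) \<le> e"
    unfolding dist_norm using SUP_ereal_less_imp[of "\<lambda>t. norm (f (t + \<tau>) - f t)" e for \<tau>] by meson
next
  assume f: "continuous_on UNIV f \<and>
     (\<forall>e>0. \<exists>l. \<forall>\<alpha>. \<exists>\<tau>\<in>{\<alpha>..\<alpha> + l}. \<forall>t. dist (f (t + \<tau>)) (f t) \<le> e)"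
  have "\<exists>l>0. \<forall>\<alpha>. \<exists>\<tau>\<in>{\<alpha>..\<alpha> + l}. (SUP t. ereal (norm (f (t + \<tau>) - f t))) < ereal e"
    if "e > 0" for e :: real
  proof -
    obtain l where l: "\<And>\<alpha>. \<exists>\<tau>\<in>{\<alpha>..\<alpha> + l}. \<forall>t. dist (f (t + \<tau>)) (f t) \<le> e / 2"
      using f \<open>e > 0\<close> by (meson half_gt_zero)
    let ?l = "l + Abs_nnreal 1"
    have "?l > 0" "\<And>\<alpha>. {\<alpha>..\<alpha> + l} \<subseteq> {\<alpha>..\<alpha> + ?l}"
      by (auto simp: nnreal_rep_eqs Abs_nnreal_inverse add_nonneg_pos)
    moreover have "(SUP t. ereal (norm (f (t + \<tau>) - f t))) < ereal e"
      if "\<forall>t. dist (f (t + \<tau>)) (f t) \<le> e / 2" for \<tau>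
    proof -
      have "(SUP t. ereal (norm (f (t + \<tau>) - f t))) \<le> ereal (e / 2)"
        using that by (intro SUP_least) (auto simp: dist_norm)
      also have "\<dots> < ereal e" using \<open>e > 0\<close> by simp
      finally show ?thesis .
    qed
    ultimately show ?thesis using l by (meson subsetD)
  qed
  then show "f \<in> AP" using f unfolding AP_def by blast
qed (auto simp: AP_def)

section \<open>Composition, uniform continuity and pairing of almost periodic functions\<close>

lemma AP_almost_periods:
  assumes "f \<in> AP" "e > 0"
  obtains l where "\<And>\<alpha>. \<exists>\<tau>\<in>{\<alpha>..\<alpha> + l}. \<forall>t. dist (f (t + \<tau>)) (f t) \<le> e"
  using assms unfolding AP_iff by blast

text \<open>An almost period of \<open>f\<close>, at the accuracy set by the modulus of continuity
  of \<open>h\<close>, is one of the composition. Sums, multiples and truncations are all of this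
  form.\<close>

lemma AP_compose:
  assumes "uniformly_continuous_on UNIV h" "f \<in> AP"
  shows "(\<lambda>t. h (f t)) \<in> AP"
  unfolding AP_iff
proof (intro conjI allI impI)
  show "continuous_on UNIV (\<lambda>t. h (f t))"
    using assms continuous_on_compose2[of UNIV h UNIV f]
    by (auto simp: AP_iff intro: uniformly_continuous_imp_continuous)
  fix e :: real assume "e > 0"
  then obtain d where d: "d > 0" "\<And>x y. dist x y < d \<Longrightarrow> dist (h x) (h y) < e"
    using assms(1) unfolding uniformly_continuous_on_def by (metis UNIV_I)
  obtain l where l: "\<And>\<alpha>. \<exists>\<tau>\<in>{\<alpha>..\<alpha> + l}. \<forall>t. dist (f (t + \<tau>)) (f t) \<le> d / 2"
    using AP_almost_periods[OF assms(2)] d(1) by (metis half_gt_zero)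
  have "dist x y \<le> d / 2 \<Longrightarrow> dist (h x) (h y) \<le> e" for x y
    using d(2)[of x y] d(1) by simp
  then show "\<exists>l. \<forall>\<alpha>. \<exists>\<tau>\<in>{\<alpha>..\<alpha> + l}. \<forall>t. dist (h (f (t + \<tau>))) (h (f t)) \<le> e"
    using l by meson
qed

text \<open>Almost periods move any two nearby points back into a compact initial segment, where
  continuity is uniform.\<close>

lemma AP_uniformly_continuous:
  assumes "f \<in> AP"
  shows "uniformly_continuous_on UNIV f"
proof -
  have "\<exists>d>0. \<forall>s t. dist s t < d \<longrightarrow> dist (f s) (f t) < e" if "e > 0" for e :: real
  proof -
    have "e / 4 > 0" using that by simp
    then obtain l where l: "\<And>\<alpha>. \<exists>\<tau>\<in>{\<alpha>..\<alpha> + l}. \<forall>t. dist (f (t + \<tau>)) (f t) \<le> e / 4"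
      using AP_almost_periods[OF assms] by metis
    \<comment> \<open>The extra 1 makes room for the second point, which lies less than 1 beyond a
      point of \<open>{0..l}\<close>.\<close>
    define K where "K = {0..l + Abs_nnreal 1}"
    have "uniformly_continuous_on K f"
      unfolding K_def using assms compact_atLeastAtMost_nnreal
      by (intro compact_uniformly_continuous) (auto simp: AP_iff intro: continuous_on_subset)
    then obtain d where d: "d > 0"
      "\<And>s t. s \<in> K \<Longrightarrow> t \<in> K \<Longrightarrow> dist s t < d \<Longrightarrow> dist (f s) (f t) < e / 4"
      using \<open>e / 4 > 0\<close> unfolding uniformly_continuous_on_def by metis
    \<comment> \<open>For \<open>t\<close> beyond \<open>l\<close>, an almost period taken between
      \<open>t - l\<close> and \<open>t\<close> leaves a remainder \<open>u \<le> l\<close>;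
      otherwise the period 0 will do.\<close>
    have reduce: "\<exists>\<tau> u. t = u + \<tau> \<and> u \<le> l \<and> (\<forall>v. dist (f (v + \<tau>)) (f v) \<le> e / 4)" for t
    proof (cases "t \<le> l")
      case True
      then show ?thesis using that by (intro exI[of _ 0] exI[of _ t]) auto
    next
      case False
      then obtain \<alpha> where \<alpha>: "t = \<alpha> + l"
        using nnreal_le_iff_add[of l t] by auto
      obtain \<tau> where \<tau>: "\<tau> \<in> {\<alpha>..\<alpha> + l}" "\<forall>v. dist (f (v + \<tau>)) (f v) \<le> e / 4"
        using l by blast
      then obtain u where "t = u + \<tau>"
        using \<alpha> nnreal_le_iff_add[of \<tau> t] by auto
      moreover have "u \<le> l"
        using \<tau>(1) \<alpha> calculation by (auto simp: nnreal_rep_eqs simp flip: real_of_nnreal_inject)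
      ultimately show ?thesis using \<tau>(2) by blast
    qed
    have le: "dist (f s) (f t) < e" if st: "dist s t < min d 1" "t \<le> s" for s t
    proof -
      from reduce[of t] obtain \<tau> u
        where u: "t = u + \<tau>" "u \<le> l" and \<tau>: "\<forall>v. dist (f (v + \<tau>)) (f v) \<le> e / 4"
        by (elim exE conjE)
      obtain w where w: "s = w + t" using st(2) nnreal_le_iff_add[of t s] by blast
      \<comment> \<open>The same almost period is removed from \<open>s\<close> and
        \<open>t\<close>, so their distance \<open>w\<close> is preserved.\<close>
      have s: "s = (u + w) + \<tau>"
        by (simp add: w u(1) ac_simps)
      have "real_of_nnreal w < min d 1"
        using st(1) unfolding w by (simp add: nnreal_rep_eqs dist_real_def)
      with u(2) have "u + w \<in> K" "u \<in> K" "dist (u + w) u < d"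
        by (auto simp: K_def nnreal_rep_eqs Abs_nnreal_inverse dist_real_def)
      then have "dist (f (u + w)) (f u) < e / 4" using d(2) by blast
      moreover have "dist (f s) (f (u + w)) \<le> e / 4" "dist (f t) (f u) \<le> e / 4"
        using \<tau> by (simp_all only: s u(1))
      ultimately show ?thesis
        using dist_triangle[of "f s" "f t" "f (u + w)"] dist_triangle[of "f (u + w)" "f t" "f u"]
          \<open>e > 0\<close> by (simp add: dist_commute)
    qed
    then have "dist s t < min d 1 \<longrightarrow> dist (f s) (f t) < e" for s t
      by (cases "t \<le> s") (metis dist_commute linear)+
    then show ?thesis using d(1) by (metis min_less_iff_conj zero_less_one)
  qed
  then show ?thesis unfolding uniformly_continuous_on_def by (metis UNIV_I)
qed

text \<open>
  Common almost periods: pick almost periods \<open>\<tau> \<gamma>\<close> of \<open>f\<close> and \<open>\<sigma> \<gamma>\<close> of \<open>g\<close> near each \<open>\<gamma>\<close>. Their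
  differences are bounded, so up to \<open>d\<close> finitely many of them occur, at \<open>\<beta> \<in> A\<close>. If the differences
  at \<open>\<gamma>\<close> and \<open>\<beta>\<close> agree up to \<open>d\<close>, then so do \<open>\<tau> \<gamma> - \<tau> \<beta>\<close> and \<open>\<sigma> \<gamma> - \<sigma> \<beta>\<close>, and uniform continuity
  of \<open>g\<close> makes the former an almost period of both functions.
\<close>

lemma AP_Pair:
  assumes f: "f \<in> AP" and g: "g \<in> AP"
  shows "(\<lambda>t. (f t, g t)) \<in> AP"
  unfolding AP_iff
proof (intro conjI allI impI)
  show "continuous_on UNIV (\<lambda>t. (f t, g t))"
    using assms by (auto simp: AP_iff intro: continuous_on_Pair)
  fix \<epsilon> :: real assume "\<epsilon> > 0"
  \<comment> \<open>The error is at most \<open>2 * e\<close> for \<open>f\<close> and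
    \<open>3 * e\<close> for \<open>g\<close>, and the distance of pairs is at most the sum.\<close>
  define e where "e = \<epsilon> / 5"
  have "e > 0" using \<open>\<epsilon> > 0\<close> by (simp add: e_def)
  obtain l1 where l1: "\<And>\<alpha>. \<exists>\<tau>\<in>{\<alpha>..\<alpha> + l1}. \<forall>t. dist (f (t + \<tau>)) (f t) \<le> e"
    using AP_almost_periods[OF f \<open>e > 0\<close>] by metis
  obtain l2 where l2: "\<And>\<alpha>. \<exists>\<sigma>\<in>{\<alpha>..\<alpha> + l2}. \<forall>t. dist (g (t + \<sigma>)) (g t) \<le> e"
    using AP_almost_periods[OF g \<open>e > 0\<close>] by metis
  from l1 obtain \<tau> where \<tau>: "\<And>\<alpha>. \<tau> \<alpha> \<in> {\<alpha>..\<alpha> + l1}" "\<And>\<alpha> t. dist (f (t + \<tau> \<alpha>)) (f t) \<le> e"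
    by metis
  from l2 obtain \<sigma> where \<sigma>: "\<And>\<alpha>. \<sigma> \<alpha> \<in> {\<alpha>..\<alpha> + l2}" "\<And>\<alpha> t. dist (g (t + \<sigma> \<alpha>)) (g t) \<le> e"
    by metis
  obtain d where d: "d > 0" "\<And>s t. dist s t < d \<Longrightarrow> dist (g s) (g t) < e"
    using AP_uniformly_continuous[OF g] \<open>e > 0\<close> unfolding uniformly_continuous_on_def
    by (metis UNIV_I)
  define D where "D \<alpha> = real_of_nnreal (\<tau> \<alpha>) - real_of_nnreal (\<sigma> \<alpha>)" for \<alpha>
  have "D \<alpha> \<in> {- real_of_nnreal l2..real_of_nnreal l1}" for \<alpha>
    using \<tau>(1)[of \<alpha>] \<sigma>(1)[of \<alpha>] by (auto simp: D_def nnreal_rep_eqs)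
  then have "bounded (range D)"
    using bounded_subset[OF bounded_closed_interval] by blast
  then have "compact (closure (range D))" by (simp add: compact_closure)
  moreover have "closure (range D) \<subseteq> (\<Union>\<beta>\<in>UNIV. ball (D \<beta>) d)"
    using d(1) by (force simp: closure_approachable)
  ultimately obtain A where A: "finite A" "closure (range D) \<subseteq> (\<Union>\<beta>\<in>A. ball (D \<beta>) d)"
    using compactE_image[of "closure (range D)" UNIV "\<lambda>\<beta>. ball (D \<beta>) d"] by (metis open_ball)
  \<comment> \<open>\<open>M\<close> dominates the finitely many reference periods, so a period
    found beyond \<open>\<alpha> + M\<close> stays above \<alpha> when one of them is subtracted.
    The 0 keeps the set nonempty.\<close>
  define M where "M = Max (insert 0 (\<tau> ` A \<union> \<sigma> ` A))"
  have M: "\<tau> \<beta> \<le> M" "\<sigma> \<beta> \<le> M" if "\<beta> \<in> A" for \<beta>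
    using that A(1) by (auto simp: M_def)
  have "\<exists>p\<in>{\<alpha>..\<alpha> + (M + l1)}. \<forall>t. dist (f (t + p), g (t + p)) (f t, g t) \<le> \<epsilon>" for \<alpha>
  proof -
    let ?\<gamma> = "\<alpha> + M"
    obtain \<beta> where \<beta>: "\<beta> \<in> A" "dist (D \<beta>) (D ?\<gamma>) < d"
      using A(2) closure_subset[of "range D"] by (force simp: mem_ball)
    have "\<tau> \<beta> \<le> \<tau> ?\<gamma>" "\<sigma> \<beta> \<le> \<sigma> ?\<gamma>"
      using M[OF \<beta>(1)] \<tau>(1)[of ?\<gamma>] \<sigma>(1)[of ?\<gamma>] real_of_nnreal_nonneg[of \<alpha>]
      unfolding atLeastAtMost_iff nnreal_rep_eqs by linarith+
    then obtain p q where p: "\<tau> ?\<gamma> = p + \<tau> \<beta>" and q: "\<sigma> ?\<gamma> = q + \<sigma> \<beta>"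
      using nnreal_le_iff_add[of "\<tau> \<beta>" "\<tau> ?\<gamma>"] nnreal_le_iff_add[of "\<sigma> \<beta>" "\<sigma> ?\<gamma>"] by blast
    have "p \<in> {\<alpha>..\<alpha> + (M + l1)}"
      using \<tau>(1)[of ?\<gamma>] M(1)[OF \<beta>(1)] real_of_nnreal_nonneg[of "\<tau> \<beta>"]
      unfolding p atLeastAtMost_iff nnreal_rep_eqs by linarith
    moreover have "dist (f (t + p), g (t + p)) (f t, g t) \<le> \<epsilon>" for t
    proof -
      \<comment> \<open>Since \<open>p + \<tau> \<beta> = \<tau> ?\<gamma>\<close>, both values are
        within \<open>e\<close> of \<open>f (t + \<tau> ?\<gamma>)\<close>.\<close>
      have "dist (f (t + p)) (f t) \<le> 2 * e"
        using \<tau>(2)[of t ?\<gamma>] \<tau>(2)[of "t + p" \<beta>] dist_triangle[of "f (t + p)" "f t" "f (t + \<tau> ?\<gamma>)"]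
        by (simp add: p add.assoc dist_commute)
      moreover have "dist (g (t + q)) (g t) \<le> 2 * e"
        using \<sigma>(2)[of t ?\<gamma>] \<sigma>(2)[of "t + q" \<beta>] dist_triangle[of "g (t + q)" "g t" "g (t + \<sigma> ?\<gamma>)"]
        by (simp add: q add.assoc dist_commute)
      \<comment> \<open>The difference of \<open>p\<close> and \<open>q\<close> is
        \<open>D ?\<gamma> - D \<beta>\<close>.\<close>
      moreover have "dist (t + p) (t + q) < d"
        using \<beta>(2) unfolding D_def p q nnreal_rep_eqs dist_real_def by linarith
      then have "dist (g (t + p)) (g (t + q)) < e" by (rule d(2))
      moreover have "dist (f (t + p), g (t + p)) (f t, g t) \<le> dist (f (t + p)) (f t) + dist (g (t + p)) (g t)"
        unfolding dist_Pair_Pair by (simp add: sqrt_sum_squares_le_sum)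
      ultimately show ?thesis
        using dist_triangle[of "g (t + p)" "g t" "g (t + q)"] by (simp add: e_def)
    qed
    ultimately show ?thesis by blast
  qed
  then show "\<exists>l. \<forall>\<alpha>. \<exists>\<tau>\<in>{\<alpha>..\<alpha> + l}. \<forall>t. dist (f (t + \<tau>), g (t + \<tau>)) (f t, g t) \<le> \<epsilon>"
    by blast
qed

section \<open>The almost periodic functions as a closed subspace\<close>

lemma AP_add:
  assumes "f \<in> AP" "g \<in> AP"
  shows "(\<lambda>t. f t + g t) \<in> AP"
proof -
  \<comment> \<open>Addition is bounded linear on pairs, so the sum is a composition with the almost
    periodic pair.\<close>
  have "uniformly_continuous_on UNIV (\<lambda>p :: 'a \<times> 'a. fst p + snd p)"
    by (rule bounded_linear.uniformly_continuous_on[OF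
          bounded_linear_add[OF bounded_linear_fst bounded_linear_snd] uniformly_continuous_on_id])
  from AP_compose[OF this AP_Pair[OF assms]] show ?thesis unfolding fst_conv snd_conv .
qed

lemma AP_scaleR: "f \<in> AP \<Longrightarrow> (\<lambda>t. c *\<^sub>R f t) \<in> AP"
  by (rule AP_compose[OF bounded_linear.uniformly_continuous_on[OF bounded_linear_scaleR_right
        uniformly_continuous_on_id]])

lemma AP_zero: "(\<lambda>t. 0) \<in> AP"
  unfolding AP_iff
proof (intro conjI allI impI exI ballI)
  show "\<exists>\<tau>\<in>{\<alpha>..\<alpha> + 0}. \<forall>t. dist 0 0 \<le> e" if "e > 0" for e :: real and \<alpha> :: nnreal
    using that by (intro bexI[of _ \<alpha>]) auto
qed simp

lemma subspace_AP: "subspace {f. apply_bcontfun f \<in> AP}"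
  by (simp add: subspace_def AP_zero AP_add AP_scaleR)

text \<open>The \<open>e / 3\<close> almost periods of a function within \<open>e / 3\<close> of
  \<open>f\<close> are \<open>e\<close> almost periods of \<open>f\<close>.\<close>

lemma closed_AP: "closed {f. apply_bcontfun f \<in> AP}"
proof -
  have "apply_bcontfun f \<in> AP"
    if f: "\<And>e. e > 0 \<Longrightarrow> \<exists>g. apply_bcontfun g \<in> AP \<and> dist g f < e" for f :: "nnreal \<Rightarrow>\<^sub>C 'a"
    unfolding AP_iff
  proof (intro conjI allI impI)
    show "continuous_on UNIV (apply_bcontfun f)" by simp
    fix e :: real assume "e > 0"
    then have "e / 3 > 0" by simp
    then obtain g where g: "apply_bcontfun g \<in> AP" "dist g f < e / 3" using f by blast
    obtain l where l: "\<And>\<alpha>. \<exists>\<tau>\<in>{\<alpha>..\<alpha> + l}. \<forall>t. dist (g (t + \<tau>)) (g t) \<le> e / 3"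
      using AP_almost_periods[OF g(1) \<open>e / 3 > 0\<close>] by metis
    have "dist (f s) (f t) \<le> e" if "dist (g s) (g t) \<le> e / 3" for s t
      using that dist_bounded[of g s f] dist_bounded[of g t f] g(2)
        dist_triangle[of "f s" "f t" "g s"] dist_triangle[of "g s" "f t" "g t"]
      by (simp add: dist_commute)
    then show "\<exists>l. \<forall>\<alpha>. \<exists>\<tau>\<in>{\<alpha>..\<alpha> + l}. \<forall>t. dist (f (t + \<tau>)) (f t) \<le> e"
      using l by meson
  qed
  then have "closure {f :: nnreal \<Rightarrow>\<^sub>C 'a. apply_bcontfun f \<in> AP} \<subseteq> {f. apply_bcontfun f \<in> AP}"
    by (auto simp: closure_approachable)
  then show ?thesis by (simp add: closure_subset_eq)
qed


section \<open>Ergodic functions\<close>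

text \<open>Means are compared at a fixed \<open>r\<close> before any limit. Where
  \<open>{0..r}\<close> has measure 0, division by zero gives the value 0.\<close>

definition mean_norm :: "nnreal measure \<Rightarrow> (nnreal \<Rightarrow>\<^sub>C 'a::real_normed_vector) \<Rightarrow> nnreal \<Rightarrow> real" where
  "mean_norm \<mu> f r = 1 / measure \<mu> {0..r} * (LINT t:{0..r}|\<mu>. norm (f t))"

lemma ergodic_iff: "f \<in> ergodic \<mu> \<longleftrightarrow> (mean_norm \<mu> f \<longlongrightarrow> 0) at_top"
  by (simp add: ergodic_def mean_norm_def[abs_def])

lemma borel_measurable_norm_bcontfun:
  fixes f :: "nnreal \<Rightarrow>\<^sub>C 'a::real_normed_vector"
  assumes "\<mu> \<in> measures_plus"
  shows "(\<lambda>t. norm (f t)) \<in> borel_measurable \<mu>"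
proof -
  have sets: "sets \<mu> = sets (vimage_algebra UNIV real_of_nnreal lebesgue)"
    using assms by (simp add: measures_plus_def lebesgue_sets_nnreal_def)
  \<comment> \<open>The \<sigma>-field is pulled back from the real line, so the function is
    extended there by zero; the extension is Borel.\<close>
  define F where "F x = indicator {0..} x *\<^sub>R norm (f (Abs_nnreal x))" for x :: real
  have "continuous_on {0..} (\<lambda>x. norm (f (Abs_nnreal x)))"
    by (intro continuous_on_norm continuous_on_compose2[OF continuous_on_apply_bcontfun[of UNIV]]
        continuous_on_Abs_nnreal) auto
  then have "F \<in> borel_measurable lebesgue"
    unfolding F_def by (intro measurable_completion) (simp add: borel_measurable_continuous_on_indicator del: real_scaleR_def)
  then have "(\<lambda>t. F (real_of_nnreal t)) \<in> borel_measurable (vimage_algebra UNIV real_of_nnreal lebesgue)"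
    by (intro measurable_compose[OF measurable_vimage_algebra1]) auto
  then show ?thesis
    by (simp add: F_def real_of_nnreal_inverse measurable_cong_sets[OF sets refl])
qed

lemma sets_initial_segment: "\<mu> \<in> measures_plus \<Longrightarrow> {0..r} \<in> sets \<mu>"
proof -
  have "real_of_nnreal ` {0..r} = {0..real_of_nnreal r}"
  proof (intro equalityI subsetI)
    fix x assume "x \<in> {0..real_of_nnreal r}"
    then show "x \<in> real_of_nnreal ` {0..r}"
      by (intro image_eqI[of _ _ "Abs_nnreal x"]) (auto simp: nnreal_rep_eqs Abs_nnreal_inverse)
  qed (auto simp: nnreal_rep_eqs)
  then show "\<mu> \<in> measures_plus \<Longrightarrow> {0..r} \<in> sets \<mu>"
    by (simp add: measures_plus_def lebesgue_sets_nnreal_eq)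
qed

lemma emeasure_initial_segment: "\<mu> \<in> measures_plus \<Longrightarrow> emeasure \<mu> {0..r} < top"
proof -
  have "0 \<le> r" by (simp add: nnreal_rep_eqs)
  then show "\<mu> \<in> measures_plus \<Longrightarrow> emeasure \<mu> {0..r} < top"
    unfolding measures_plus_def infinity_ennreal_def by blast
qed

section \<open>Integrals and means over initial segments\<close>

lemma set_integrable_norm_bcontfun:
  fixes f :: "nnreal \<Rightarrow>\<^sub>C 'a::real_normed_vector"
  assumes "\<mu> \<in> measures_plus"
  shows "set_integrable \<mu> {0..r} (\<lambda>t. norm (f t))"
  unfolding set_integrable_def
  by (rule integrableI_bounded_set_indicator[where B = "norm f"])
    (use assms in \<open>auto simp: sets_initial_segment borel_measurable_norm_bcontfun
      emeasure_initial_segment norm_bounded\<close>)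

lemma set_integrable_const_initial_segment:
  "\<mu> \<in> measures_plus \<Longrightarrow> set_integrable \<mu> {0..r} (\<lambda>t. c :: real)"
  unfolding set_integrable_def
  by (rule integrableI_bounded_set_indicator[where B = "\<bar>c\<bar>"])
    (auto simp: sets_initial_segment emeasure_initial_segment)

lemma mean_norm_nonneg: "0 \<le> mean_norm \<mu> f r"
  unfolding mean_norm_def set_lebesgue_integral_def by simp

text \<open>The constant \<open>c\<close> is 0 in domination arguments and absorbs the uniform error
  in the proof of closedness.\<close>

lemma mean_norm_le:
  fixes f :: "nnreal \<Rightarrow>\<^sub>C 'a::real_normed_vector"
    and g :: "nnreal \<Rightarrow>\<^sub>C 'b::real_normed_vector"
    and h :: "nnreal \<Rightarrow>\<^sub>C 'c::real_normed_vector"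
  assumes \<mu>: "\<mu> \<in> measures_plus" and "c \<ge> 0"
    and le: "\<And>t. norm (f t) \<le> a * norm (g t) + norm (h t) + c"
  shows "mean_norm \<mu> f r \<le> a * mean_norm \<mu> g r + mean_norm \<mu> h r + c"
proof -
  note int = set_integrable_norm_bcontfun[OF \<mu>, of r] set_integrable_const_initial_segment[OF \<mu>, of r]
  have "(LINT t:{0..r}|\<mu>. norm (f t)) \<le> (LINT t:{0..r}|\<mu>. a * norm (g t) + norm (h t) + c)"
    using le by (intro set_integral_mono set_integral_add set_integrable_mult_right int)
  also have "\<dots> = a * (LINT t:{0..r}|\<mu>. norm (g t)) + (LINT t:{0..r}|\<mu>. norm (h t)) + c * measure \<mu> {0..r}"
    by (simp add: set_integral_add set_integrable_mult_right int)
       (simp add: set_lebesgue_integral_def sets.Int_space_eq2 sets_initial_segment[OF \<mu>])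
  finally have "mean_norm \<mu> f r \<le> 1 / measure \<mu> {0..r} *
      (a * (LINT t:{0..r}|\<mu>. norm (g t)) + (LINT t:{0..r}|\<mu>. norm (h t)) + c * measure \<mu> {0..r})"
    unfolding mean_norm_def by (intro mult_left_mono) auto
  \<comment> \<open>If the measure is 0, all means vanish and \<open>c \<ge> 0\<close> suffices;
    otherwise equality holds.\<close>
  also have "\<dots> \<le> a * mean_norm \<mu> g r + mean_norm \<mu> h r + c"
    using \<open>c \<ge> 0\<close> by (cases "measure \<mu> {0..r} = 0") (auto simp: mean_norm_def field_simps)
  finally show ?thesis .
qed

text \<open>The mean is squeezed between 0 and a combination of two null means. Sums, multiples and
  the truncation error are handled this way.\<close>

lemma ergodic_dominated:
  fixes f :: "nnreal \<Rightarrow>\<^sub>C 'a::real_normed_vector"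
    and g :: "nnreal \<Rightarrow>\<^sub>C 'b::real_normed_vector"
    and h :: "nnreal \<Rightarrow>\<^sub>C 'c::real_normed_vector"
  assumes \<mu>: "\<mu> \<in> measures_plus" and g: "g \<in> ergodic \<mu>" and h: "h \<in> ergodic \<mu>"
    and le: "\<And>t. norm (f t) \<le> a * norm (g t) + norm (h t)"
  shows "f \<in> ergodic \<mu>"
  unfolding ergodic_iff
proof (rule tendsto_sandwich[of "\<lambda>_. 0"])
  show "((\<lambda>r. a * mean_norm \<mu> g r + mean_norm \<mu> h r) \<longlongrightarrow> 0) at_top"
    using tendsto_add[OF tendsto_mult_right_zero h[unfolded ergodic_iff]] g
    by (simp add: ergodic_iff)
  show "\<forall>\<^sub>F r in at_top. mean_norm \<mu> f r \<le> a * mean_norm \<mu> g r + mean_norm \<mu> h r"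
    using mean_norm_le[OF \<mu>, of 0 f a g h] le by simp
qed (simp_all add: mean_norm_nonneg)

lemma zero_in_ergodic: "0 \<in> ergodic \<mu>"
  by (simp add: ergodic_def set_lebesgue_integral_def)

lemma subspace_ergodic:
  assumes "\<mu> \<in> measures_plus"
  shows "subspace (ergodic \<mu>)"
proof (rule subspaceI)
  fix f g :: "nnreal \<Rightarrow>\<^sub>C 'a" and c
  assume f: "f \<in> ergodic \<mu>"
  show "c *\<^sub>R f \<in> ergodic \<mu>"
    by (rule ergodic_dominated[OF assms f zero_in_ergodic, where a = "\<bar>c\<bar>"])
      (simp add: scaleR_bcontfun.rep_eq)
  assume "g \<in> ergodic \<mu>"
  then show "f + g \<in> ergodic \<mu>"
    by (rule ergodic_dominated[OF assms f, where a = 1])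
      (simp add: plus_bcontfun.rep_eq norm_triangle_ineq)
qed (rule zero_in_ergodic)

lemma closed_ergodic:
  assumes \<mu>: "\<mu> \<in> measures_plus"
  shows "closed (ergodic \<mu> :: (nnreal \<Rightarrow>\<^sub>C 'a::real_normed_vector) set)"
proof -
  have "f \<in> ergodic \<mu>" if f: "\<And>e. e > 0 \<Longrightarrow> \<exists>g\<in>ergodic \<mu>. dist g f < e" for f :: "nnreal \<Rightarrow>\<^sub>C 'a"
    unfolding ergodic_iff tendsto_iff
  proof (intro allI impI)
    fix e :: real assume "e > 0"
    then obtain g where g: "g \<in> ergodic \<mu>" "dist g f < e / 2"
      using f half_gt_zero by blast
    have "norm (f t) \<le> 1 * norm (g t) + norm ((0 :: nnreal \<Rightarrow>\<^sub>C 'a) t) + e / 2" for t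
      using dist_bounded[of g t f] g(2) norm_triangle_ineq2[of "f t" "g t"]
      by (simp add: dist_norm norm_minus_commute)
    then have le: "mean_norm \<mu> f r \<le> 1 * mean_norm \<mu> g r + mean_norm \<mu> (0 :: nnreal \<Rightarrow>\<^sub>C 'a) r + e / 2" for r
      using \<open>e > 0\<close> by (intro mean_norm_le[OF \<mu>]) auto
    moreover have "mean_norm \<mu> (0 :: nnreal \<Rightarrow>\<^sub>C 'a) r = 0" for r
      by (simp add: mean_norm_def set_lebesgue_integral_def)
    moreover have "\<forall>\<^sub>F r in at_top. dist (mean_norm \<mu> g r) 0 < e / 2"
      using g(1) \<open>e > 0\<close> half_gt_zero unfolding ergodic_iff tendsto_iff by blast
    ultimately show "\<forall>\<^sub>F r in at_top. dist (mean_norm \<mu> f r) 0 < e"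
      by (auto elim!: eventually_mono simp: mean_norm_nonneg dist_real_def)
        (smt (verit) mean_norm_nonneg field_sum_of_halves)
  qed
  then have "closure (ergodic \<mu> :: (nnreal \<Rightarrow>\<^sub>C 'a) set) \<subseteq> ergodic \<mu>"
    by (auto simp: closure_approachable)
  then show ?thesis by (simp add: closure_subset_eq)
qed


section \<open>Sums of closed subspaces\<close>

text \<open>The supremum norm is complete here, so closed subsets are complete.\<close>

instance bcontfun :: (metric_space, banach) banach ..

text \<open>A point of the closure is approximated with geometrically small increments. The bound
  makes their parts in \<open>A\<close> summable to some \<open>G\<close> in \<open>A\<close>; what
  remains converges in \<open>E\<close>.\<close>

lemma closed_sum_of_norm_bounded:
  fixes A E :: "'a::banach set"
  assumes A: "subspace A" "closed A" and E: "subspace E" "closed E"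
    and bound: "\<And>h. h \<in> {g + \<phi> | g \<phi>. g \<in> A \<and> \<phi> \<in> E} \<Longrightarrow> \<exists>g\<in>A. norm g \<le> norm h \<and> h - g \<in> E"
  shows "closed {g + \<phi> | g \<phi>. g \<in> A \<and> \<phi> \<in> E}"
proof -
  define S where "S = {g + \<phi> | g \<phi>. g \<in> A \<and> \<phi> \<in> E}"
  have S: "subspace S" unfolding S_def by (rule subspace_sums[OF A(1) E(1)])
  have "f \<in> S" if "f \<in> closure S" for f
  proof -
    have "\<exists>h\<in>S. dist h f < (1/2)^n" for n :: nat
    proof -
      have "(0::real) < (1/2)^n" by simp
      with that show ?thesis unfolding closure_approachable by blast
    qed
    then obtain h where h: "\<And>n :: nat. h n \<in> S" "\<And>n. dist (h n) f < (1/2)^n" by metis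
    have diff: "h (Suc n) - h n \<in> S" for n
      using subspace_diff[OF S h(1) h(1)] .
    then have "\<forall>n. \<exists>g\<in>A. norm g \<le> norm (h (Suc n) - h n) \<and> h (Suc n) - h n - g \<in> E"
      using bound[folded S_def] by blast
    then obtain g where g: "\<And>n. g n \<in> A" "\<And>n. norm (g n) \<le> norm (h (Suc n) - h n)"
      "\<And>n. h (Suc n) - h n - g n \<in> E"
      by metis
    have "norm (g n) \<le> 2 * (1/2)^n" for n
    proof -
      have "norm (h (Suc n) - h n) \<le> dist (h (Suc n)) f + dist (h n) f"
        using dist_triangle2 by (metis dist_norm)
      also have "\<dots> \<le> (1/2)^Suc n + (1/2)^n"
        using h(2)[of n] h(2)[of "Suc n"] by linarith
      also have "\<dots> \<le> 2 * (1/2)^n" by simp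
      finally show ?thesis using g(2)[of n] by simp
    qed
    moreover have "summable (\<lambda>n. 2 * (1/2 :: real)^n)"
      by (rule summable_mult, rule summable_geometric) simp
    ultimately have "summable g"
      by (rule summable_comparison_test'[where N = 0, rotated])
    then obtain G where G: "(\<lambda>n. \<Sum>k<n. g k) \<longlonglongrightarrow> G"
      using summable_LIMSEQ by blast
    have "G \<in> A"
      by (rule closed_sequentially[OF A(2) _ G]) (intro subspace_sum A(1) g(1))
    have "(\<lambda>n. (1/2 :: real)^n) \<longlonglongrightarrow> 0" by (rule LIMSEQ_power_zero) simp
    then have hf: "h \<longlonglongrightarrow> f"
      unfolding tendsto_dist_iff[of h]
      by (rule tendsto_sandwich[of "\<lambda>_. 0", rotated 3]) (simp_all add: less_imp_le[OF h(2)])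
    \<comment> \<open>Telescoping turns this into the sum of the parts of the increments in
      \<open>E\<close>.\<close>
    have partial: "h n - h 0 - (\<Sum>k<n. g k) \<in> E" for n
    proof -
      have "h n - h 0 - (\<Sum>k<n. g k) = (\<Sum>k<n. h (Suc k) - h k - g k)"
        by (simp only: sum_subtractf[of _ g] sum_lessThan_telescope)
      then show ?thesis by (simp only:) (intro subspace_sum E(1) g(3))
    qed
    have "f - h 0 - G \<in> E"
      using closed_sequentially[OF E(2) partial tendsto_diff[OF tendsto_diff[OF hf tendsto_const] G]] .
    \<comment> \<open>The term \<open>h 0\<close> was left undecomposed; it lies in \<open>S\<close>
      and is added back.\<close>
    then have "G + (f - h 0 - G) \<in> S" using \<open>G \<in> A\<close> unfolding S_def by blast
    from subspace_add[OF S h(1)[of 0] this] show ?thesis by simp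
  qed
  then show ?thesis unfolding S_def[symmetric] by (meson closure_subset_eq subsetI)
qed


section \<open>Truncation\<close>

text \<open>For \<open>d > 0\<close> this is the identity on the closed ball of radius
  \<open>d\<close> and scales other vectors to norm \<open>d\<close>; the \<open>max\<close> joins
  both cases.\<close>

definition radial_retraction :: "real \<Rightarrow> 'a::real_normed_vector \<Rightarrow> 'a" where
  "radial_retraction d x = (d / max d (norm x)) *\<^sub>R x"

lemma norm_radial_retraction_le: "d > 0 \<Longrightarrow> norm (radial_retraction d x) \<le> d"
  unfolding radial_retraction_def by (auto simp: max_def field_simps)

lemma norm_diff_radial_retraction:
  assumes "d > 0"
  shows "norm (x - radial_retraction d x) = max 0 (norm x - d)"
proof (cases "norm x \<le> d")
  case True
  then show ?thesis using assms by (simp add: radial_retraction_def max_absorb1)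
next
  case False
  have "x - radial_retraction d x = (1 - d / norm x) *\<^sub>R x"
    using False by (simp add: radial_retraction_def scaleR_left_diff_distrib)
  moreover have "0 \<le> 1 - d / norm x" using False assms by (simp add: divide_le_eq)
  ultimately have "norm (x - radial_retraction d x) = (1 - d / norm x) * norm x" by simp
  also have "\<dots> = norm x - d" using False assms by (auto simp: left_diff_distrib)
  finally show ?thesis using False by simp
qed

text \<open>The difference splits into a scaled \<open>x - y\<close> and a change of the scaling
  factor at \<open>y\<close>. Each has norm at most \<open>norm (x - y)\<close>, whence the factor
  2.\<close>

lemma dist_radial_retraction:
  assumes "d > 0"
  shows "dist (radial_retraction d x) (radial_retraction d y) \<le> 2 * dist x y"
proof -
  define a b where "a = max d (norm x)" and "b = max d (norm y)"
  have ab: "d \<le> a" "d \<le> b" "norm y \<le> b" "0 < a" "0 < b" using assms by (auto simp: a_def b_def)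
  have "\<bar>b - a\<bar> \<le> \<bar>norm y - norm x\<bar>" by (auto simp: a_def b_def)
  also have "\<dots> \<le> norm (x - y)" by (metis norm_minus_commute norm_triangle_ineq3)
  finally have ba: "\<bar>b - a\<bar> \<le> norm (x - y)" .
  \<comment> \<open>This form isolates \<open>b - a\<close>, controlled by
    \<open>norm (x - y)\<close>, next to the factors \<open>d / a\<close> and
    \<open>norm y / b\<close>, both at most 1.\<close>
  have "d / a - d / b = d / a * ((b - a) / b)" using ab by (simp add: field_simps)
  then have "\<bar>d / a - d / b\<bar> * norm y = d / a * \<bar>b - a\<bar> * (norm y / b)"
    using ab assms by (simp add: abs_mult)
  also have "\<dots> \<le> 1 * norm (x - y) * 1"
    using ab assms ba by (intro mult_mono) auto
  finally have second: "norm ((d / a - d / b) *\<^sub>R y) \<le> norm (x - y)" by simp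
  have "d / a * norm (x - y) \<le> 1 * norm (x - y)" using ab by (intro mult_right_mono) auto
  then have first: "norm ((d / a) *\<^sub>R (x - y)) \<le> norm (x - y)" using ab assms by simp
  have "radial_retraction d x - radial_retraction d y = (d / a) *\<^sub>R (x - y) + (d / a - d / b) *\<^sub>R y"
    by (simp add: radial_retraction_def a_def b_def algebra_simps)
  then show ?thesis
    using first second norm_triangle_ineq[of "(d / a) *\<^sub>R (x - y)" "(d / a - d / b) *\<^sub>R y"]
    by (simp add: dist_norm)
qed

lemma uniformly_continuous_radial_retraction:
  assumes "d > 0"
  shows "uniformly_continuous_on UNIV (radial_retraction d)"
  unfolding uniformly_continuous_on_def
proof (intro allI impI)
  fix e :: real assume "e > 0"
  then show "\<exists>d'>0. \<forall>x\<in>UNIV. \<forall>y\<in>UNIV. dist y x < d' \<longrightarrow>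
      dist (radial_retraction d y) (radial_retraction d x) < e"
    using dist_radial_retraction[OF assms] by (intro exI[of _ "e / 2"]) (fastforce intro: le_less_trans)
qed

section \<open>Pseudo almost periodic functions and norm-bounded decompositions\<close>

lemma norm_bounded_decomposition:
  fixes f :: "nnreal \<Rightarrow>\<^sub>C 'a::real_normed_vector"
  assumes \<mu>: "\<mu> \<in> measures_plus" and g: "apply_bcontfun g \<in> AP" and \<phi>: "\<phi> \<in> ergodic \<mu>"
    and f: "f = g + \<phi>"
  shows "\<exists>g'. apply_bcontfun g' \<in> AP \<and> norm g' \<le> norm f \<and> f - g' \<in> ergodic \<mu>"
proof (cases "f = 0")
  \<comment> \<open>The retraction needs a positive radius, so \<open>f = 0\<close> is treated
    apart, with \<open>g' = 0\<close>.\<close>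
  case True
  then show ?thesis
    by (intro exI[of _ 0]) (simp add: zero_in_ergodic zero_bcontfun.rep_eq AP_zero)
next
  case False
  define d where "d = norm f"
  have "d > 0" using False by (simp add: d_def)
  have AP: "(\<lambda>t. radial_retraction d (g t)) \<in> AP"
    by (rule AP_compose[OF uniformly_continuous_radial_retraction[OF \<open>d > 0\<close>] g])
  define g' where "g' = Bcontfun (\<lambda>t. radial_retraction d (g t))"
  have "(\<lambda>t. radial_retraction d (g t)) \<in> bcontfun"
    using AP norm_radial_retraction_le[OF \<open>d > 0\<close>]
    by (intro bcontfun_normI[of _ d]) (auto simp: AP_iff)
  then have g': "g' t = radial_retraction d (g t)" for t
    by (simp add: g'_def Bcontfun_inverse)
  have "norm g' \<le> norm f"
    using norm_radial_retraction_le[OF \<open>d > 0\<close>] by (intro norm_bound) (simp add: g' d_def)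
  moreover have "g - g' \<in> ergodic \<mu>"
  proof (rule ergodic_dominated[OF \<mu> \<phi> zero_in_ergodic])
    fix t
    have "norm (g t) \<le> norm (f t) + norm (\<phi> t)"
      using norm_triangle_ineq4[of "f t" "\<phi> t"] by (simp add: f plus_bcontfun.rep_eq)
    also have "norm (f t) \<le> d" by (simp add: d_def norm_bounded)
    finally show "norm ((g - g') t) \<le> 1 * norm (\<phi> t) + norm ((0 :: nnreal \<Rightarrow>\<^sub>C 'a) t)"
      using norm_diff_radial_retraction[OF \<open>d > 0\<close>, of "g t"] by (simp add: minus_bcontfun.rep_eq g')
  qed
  \<comment> \<open>Here \<open>f - g' = \<phi> + (g - g')\<close>, a sum of two ergodic
    functions.\<close>
  then have "f - g' \<in> ergodic \<mu>"
    using subspace_add[OF subspace_ergodic[OF \<mu>] \<phi>, of "g - g'"] by (simp add: f algebra_simps)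
  moreover have "apply_bcontfun g' \<in> AP"
    using AP unfolding g'[symmetric] .
  ultimately show ?thesis by blast
qed

text \<open>The almost periodic part in \<open>PAP\<close> is a plain function, but it equals
  \<open>f - \<phi>\<close> and so lifts to the type of bounded continuous functions.\<close>

lemma PAP_eq: "PAP \<mu> = {g + \<phi> | g \<phi>. g \<in> {g. apply_bcontfun g \<in> AP} \<and> \<phi> \<in> ergodic \<mu>}"
proof (intro equalityI subsetI)
  fix f assume "f \<in> PAP \<mu>"
  then obtain g \<phi> where g: "g \<in> AP" and \<phi>: "\<phi> \<in> ergodic \<mu>" and f: "\<And>t. f t = g t + \<phi> t"
    unfolding PAP_def by blast
  have "g = apply_bcontfun (f - \<phi>)" by (simp add: fun_eq_iff minus_bcontfun.rep_eq f)
  with g have "apply_bcontfun (f - \<phi>) \<in> AP" by simp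
  moreover have "f = (f - \<phi>) + \<phi>" by simp
  ultimately show "f \<in> {g + \<phi> | g \<phi>. g \<in> {g. apply_bcontfun g \<in> AP} \<and> \<phi> \<in> ergodic \<mu>}"
    using \<phi> by blast
next
  fix f assume "f \<in> {g + \<phi> | g \<phi>. g \<in> {g. apply_bcontfun g \<in> AP} \<and> \<phi> \<in> ergodic \<mu>}"
  then obtain g \<phi> where "f = g + \<phi>" "apply_bcontfun g \<in> AP" "\<phi> \<in> ergodic \<mu>"
    by blast
  then show "f \<in> PAP \<mu>"
    unfolding PAP_def by (intro CollectI bexI[of _ "apply_bcontfun g"] bexI[of _ \<phi>]) simp_all
qed

theorem theorem7p5:
  fixes \<mu> :: "nnreal measure"
  assumes "\<mu> \<in> measures_plus"
  shows "subspace (PAP \<mu> :: (nnreal \<Rightarrow>\<^sub>C 'x::banach) set) \<and>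
         complete (PAP \<mu> :: (nnreal \<Rightarrow>\<^sub>C 'x) set)"
proof
  show "subspace (PAP \<mu> :: (nnreal \<Rightarrow>\<^sub>C 'x) set)"
    unfolding PAP_eq by (rule subspace_sums[OF subspace_AP subspace_ergodic[OF assms]])
  have "closed (PAP \<mu> :: (nnreal \<Rightarrow>\<^sub>C 'x) set)"
    unfolding PAP_eq
    by (rule closed_sum_of_norm_bounded[OF subspace_AP closed_AP subspace_ergodic[OF assms]
          closed_ergodic[OF assms]])
      (use norm_bounded_decomposition[OF assms] in blast)
  then show "complete (PAP \<mu> :: (nnreal \<Rightarrow>\<^sub>C 'x) set)"
    by (simp add: complete_eq_closed)
qed

end
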